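(* Let $p,q$ be positive integers, $n=p+q+1$, $a>1$. Let $\mathcal{X}=(R_1,\ldots,R_n)$ with $R_i=\sum_{j=1}^nc_{ij}x_j+c_{i0}$, $c_{ij}\in\mathbb{R}$, be a degree one vector field defined on $S_{p,q}$. Then $\mathcal{X}$ can have at most as many invariant meridians as there are linearly independent real eigenvectors of the matrix $A=(c_{ij})_{1\le i,j\le p+1}$ formed by the coefficients of the polynomials in the vector field $\mathcal{X}$.
   Context: $S_{p,q}\subset\mathbb{R}^n$ is the hypersurface $\{h=0\}$, where $h=\left(\sum_{i=1}^{p+1}x_i^2-a^2\right)^2+\sum_{j=p+2}^{n}x_j^2-1$. A polynomial vector field $\mathcal{X}=(R_1,\ldots,R_n)=\sum_iR_i\,\partial/\partial x_i$ has degree $\max_i\deg R_i$ and is defined on $S_{p,q}$ if $\mathcal{X}h=Kh$ for some $K\in\mathbb{R}[x_1,\ldots,x_n]$. A meridian on $S_{p,q}$ is the intersection of $S_{p,q}$ with a hyperplane $\{\sum_{i=1}^{p+1}a_ix_i=0\}$, $a_i\in\mathbb{R}$; it is invariant for $\mathcal{X}$ if $\mathcal{X}(\sum_ia_ix_i)=K\sum_ia_ix_i$ for some $K\in\mathbb{R}[x_1,\ldots,x_n]$. Counting convention: only hypersurfaces of finite multiplicity are considered, and they are counted with multiplicity. With $W=\mathrm{span}\{x_1,\ldots,x_{p+1}\}$ and extactic polynomial $\mathcal{E}_W(\mathcal{X})=\det\big(\mathcal{X}^{r-1}(x_s)\big)_{1\le r,s\le p+1}$, the multiplicity of $\{g=0\}$,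 $g\in W$, is the largest $\mu$ with $g^\mu\mid\mathcal{E}_W(\mathcal{X})$ if $\mathcal{E}_W(\mathcal{X})\ne0$, and is undefined if $\mathcal{E}_W(\mathcal{X})=0$. *)

theory Defs
  imports
    Complex_Main
    "HOL-Library.Poly_Mapping"
    "HOL-Library.FuncSet"
    "Jordan_Normal_Form.Char_Poly"
    "Jordan_Normal_Form.VS_Connect"
begin

text \<open>
  Real polynomials in the variables \<open>x\<^sub>i\<close>, \<open>i\<close> a natural number: finitely supported maps from
  monomials (exponent vectors) to coefficients. The ring \<open>\<real>[x\<^sub>1, \<dots>, x\<^sub>n]\<close> is the subring
  \<open>polys n\<close>.
\<close>

type_synonym rpoly = "(nat \<Rightarrow>\<^sub>0 nat) \<Rightarrow>\<^sub>0 real"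

definition X :: "nat \<Rightarrow> rpoly" where
  "X i = Poly_Mapping.single (Poly_Mapping.single i 1) 1"

definition Cst :: "real \<Rightarrow> rpoly" where
  "Cst r = Poly_Mapping.single 0 r"

definition polys :: "nat \<Rightarrow> rpoly set" where
  "polys n = {f. \<forall>m \<in> Poly_Mapping.keys f. Poly_Mapping.keys m \<subseteq> {1..n}}"

text \<open>The zero polynomial gets total degree 0.\<close>

definition total_degree :: "rpoly \<Rightarrow> nat" where
  "total_degree f = Max (insert 0
     ((\<lambda>m. \<Sum>i\<in>Poly_Mapping.keys m. Poly_Mapping.lookup m i) ` Poly_Mapping.keys f))"

definition peval :: "(nat \<Rightarrow> real) \<Rightarrow> rpoly \<Rightarrow> real" where
  "peval x f = (\<Sum>m\<in>Poly_Mapping.keys f. Poly_Mapping.lookup f m *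
     (\<Prod>i\<in>Poly_Mapping.keys m. x i ^ Poly_Mapping.lookup m i))"

text \<open>If \<open>x\<^sub>i\<close> does not occur in \<open>m\<close>, the truncated difference of exponents is harmless because
  the coefficient vanishes.\<close>

definition partial :: "nat \<Rightarrow> rpoly \<Rightarrow> rpoly" where
  "partial i f = (\<Sum>m\<in>Poly_Mapping.keys f.
     Poly_Mapping.single (m - Poly_Mapping.single i 1)
       (real (Poly_Mapping.lookup m i) * Poly_Mapping.lookup f m))"

text \<open>A vector field \<open>(R\<^sub>1, \<dots>, R\<^sub>n)\<close> on \<open>\<real>\<^sup>n\<close> is a family \<open>R\<close> of which only the values
  at \<open>1, \<dots>, n\<close> matter.\<close>

definition vf_apply :: "nat \<Rightarrow> (nat \<Rightarrow> rpoly) \<Rightarrow> rpoly \<Rightarrow> rpoly" where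
  "vf_apply n R f = (\<Sum>i=1..n. R i * partial i f)"

definition vf_degree :: "nat \<Rightarrow> (nat \<Rightarrow> rpoly) \<Rightarrow> nat" where
  "vf_degree n R = Max ((\<lambda>i. total_degree (R i)) ` {1..n})"

definition vf_invariant :: "nat \<Rightarrow> (nat \<Rightarrow> rpoly) \<Rightarrow> rpoly \<Rightarrow> bool" where
  "vf_invariant n R f \<longleftrightarrow> (\<exists>K \<in> polys n. vf_apply n R f = K * f)"

text \<open>Points of \<open>\<real>\<^sup>n\<close> are functions on \<open>{1..n}\<close> (extensional, i.e. \<open>undefined\<close> elsewhere).\<close>

definition zero_set :: "nat \<Rightarrow> rpoly \<Rightarrow> (nat \<Rightarrow> real) set" where
  "zero_set n f = {x \<in> {1..n} \<rightarrow>\<^sub>E UNIV. peval x f = 0}"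

definition S_poly :: "nat \<Rightarrow> nat \<Rightarrow> real \<Rightarrow> rpoly" where
  "S_poly p q a =
     ((\<Sum>i=1..p+1. X i ^ 2) - Cst (a ^ 2)) ^ 2 + (\<Sum>j=p+2..p+q+1. X j ^ 2) - 1"

definition S_surface :: "nat \<Rightarrow> nat \<Rightarrow> real \<Rightarrow> (nat \<Rightarrow> real) set" where
  "S_surface p q a = zero_set (p+q+1) (S_poly p q a)"

definition vf_defined_on_S :: "nat \<Rightarrow> nat \<Rightarrow> real \<Rightarrow> (nat \<Rightarrow> rpoly) \<Rightarrow> bool" where
  "vf_defined_on_S p q a R \<longleftrightarrow> vf_invariant (p+q+1) R (S_poly p q a)"

definition W_space :: "nat \<Rightarrow> rpoly set" where
  "W_space p = {g. \<exists>b. g = (\<Sum>i=1..p+1. Cst (b i) * X i)}"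

definition meridian :: "nat \<Rightarrow> nat \<Rightarrow> real \<Rightarrow> rpoly \<Rightarrow> (nat \<Rightarrow> real) set" where
  "meridian p q a g = S_surface p q a \<inter> zero_set (p+q+1) g"

text \<open>Matrix indices start at 0, so the entry \<open>(r, s)\<close> below is the entry
  \<open>(r+1, s+1)\<close> of the usual 1-based description.\<close>

definition extactic :: "nat \<Rightarrow> nat \<Rightarrow> (nat \<Rightarrow> rpoly) \<Rightarrow> rpoly" where
  "extactic p q R =
     det (mat (p+1) (p+1) (\<lambda>(r, s). (vf_apply (p+q+1) R ^^ r) (X (s+1))))"

text \<open>\<open>None\<close> means that the multiplicity is undefined. Divisibility is taken in the ring of
  all polynomials; for elements of \<open>polys n\<close> it agrees with divisibility in \<open>polys n\<close> (set
  the remaining variables to 0 in the cofactor).\<close>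

definition form_multiplicity :: "nat \<Rightarrow> nat \<Rightarrow> (nat \<Rightarrow> rpoly) \<Rightarrow> rpoly \<Rightarrow> nat option" where
  "form_multiplicity p q R g =
     (if extactic p q R = 0 then None
      else Some (GREATEST \<mu>. g ^ \<mu> dvd extactic p q R))"

text \<open>The invariant meridians that are counted, as subsets of the hypersurface. The linear form
  \<open>g\<close> is nonzero since \<open>{g = 0}\<close> has to be a hyperplane.\<close>

definition invariant_meridians ::
    "nat \<Rightarrow> nat \<Rightarrow> real \<Rightarrow> (nat \<Rightarrow> rpoly) \<Rightarrow> (nat \<Rightarrow> real) set set" where
  "invariant_meridians p q a R =
     {M. \<exists>g \<in> W_space p - {0}. M = meridian p q a g \<and> vf_invariant (p+q+1) R g \<and>
           form_multiplicity p q R g \<noteq> None}"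

text \<open>For \<open>p, q > 0\<close> and \<open>a > 1\<close> a meridian determines its hyperplane, hence \<open>g\<close> up to a
  nonzero scalar, which does not affect the multiplicity.\<close>

definition meridian_multiplicity ::
    "nat \<Rightarrow> nat \<Rightarrow> real \<Rightarrow> (nat \<Rightarrow> rpoly) \<Rightarrow> (nat \<Rightarrow> real) set \<Rightarrow> nat" where
  "meridian_multiplicity p q a R M =
     (THE \<mu>. \<exists>g \<in> W_space p - {0}. M = meridian p q a g \<and>
               form_multiplicity p q R g = Some \<mu>)"

definition num_indep_eigenvectors :: "real mat \<Rightarrow> nat" where
  "num_indep_eigenvectors A = Max {card B | B. finite B \<and>
     B \<subseteq> {v. \<exists>k. eigenvector A v k} \<and>
     module.lin_indpt class_ring (module_vec TYPE(real) (dim_row A)) B}"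

end

theory Submission
  imports Defs
begin

text \<open>
  Write \<open>m = p + 1\<close>, split \<open>\<real>\<^sup>n\<close> into the block \<open>y = (x\<^sub>1, \<dots>, x\<^sub>m)\<close> and the block \<open>z\<close> of the
  remaining coordinates, and let \<open>A\<close> be the upper left block of the coefficients of the vector
  field. At a point of \<open>S\<close> the vector field is orthogonal to the gradient of
  \<open>h = (|y|\<^sup>2 - a\<^sup>2)\<^sup>2 + |z|\<^sup>2 - 1\<close>. At the points with \<open>z = 0\<close>, \<open>|y|\<^sup>2 = a\<^sup>2 + 1\<close> this says that
  \<open>A\<close> is skew-symmetric and that the constant terms of \<open>R\<^sub>1, \<dots>, R\<^sub>m\<close> vanish; at points where
  both blocks are nonzero it says that \<open>R\<^sub>1, \<dots>, R\<^sub>m\<close> do not involve \<open>z\<close>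
  (\<open>skew_symmetric\<close>, \<open>diagonal_and_constant_vanish\<close>, \<open>no_transversal_coupling\<close>). So the first
  block of the field is \<open>y \<mapsto> A y\<close>.

  If the form \<open>g = b \<cdot> y\<close> is invariant, then \<open>g\<close> divides \<open>- (A b) \<cdot> y\<close>. Since \<open>g\<close> vanishes at
  \<open>y = A b\<close>, it follows that \<open>A b = 0\<close>: the vector \<open>b\<close> is a real eigenvector and \<open>g\<close> is a first
  integral (\<open>invariant_linform_in_kernel\<close>). It remains to show that, as soon as the extactic
  polynomial \<open>\<E>\<close> is nonzero, there is at most one invariant meridian and its multiplicity is at
  most one; the sum in question is then at most 1, and it is 0 unless \<open>A\<close> has a
  real eigenvector.

  Both facts come from the relation \<open>M b = (g, 0, \<dots>, 0)\<close>, where \<open>M\<close> is the extactic matrix. With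
  a second first integral \<open>g' = b' \<cdot> y\<close> it gives \<open>M (g' b - g b') = 0\<close>, and \<open>det M \<noteq> 0\<close> makes the two
  forms proportional (\<open>linear_first_integrals_proportional\<close>). By Cramer's rule it gives
  \<open>\<E> b\<^sub>j = C\<^sub>j g\<close>, where \<open>C\<^sub>j\<close> is a cofactor of the first row. If \<open>g\<^sup>2\<close> divided \<open>\<E>\<close>, then \<open>C\<^sub>j\<close>
  would vanish on the hyperplane \<open>g = 0\<close>. But the rows entering \<open>C\<^sub>j\<close> are functions of \<open>A y\<close>,
  hence constant along the direction \<open>b\<close>, which is transversal to the hyperplane; so \<open>C\<^sub>j\<close> and
  with it \<open>\<E>\<close> would be zero (\<open>extactic_not_divisible_by_square\<close>).
\<close>

section \<open>Evaluation of polynomials\<close>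

text \<open>Bilinear identities such as multiplicativity of evaluation or the Leibniz rule thus need to
  be checked for monomials only.\<close>

lemma rpoly_monomial_induct [case_names single add]:
  fixes f :: rpoly
  assumes single: "\<And>m c. P (Poly_Mapping.single m c)"
    and add: "\<And>f g. P f \<Longrightarrow> P g \<Longrightarrow> P (f + g)"
  shows "P f"
proof -
  have "P (\<Sum>m\<in>A. Poly_Mapping.single m (Poly_Mapping.lookup f m))" if "finite A" for A
    using that
  proof (induction A)
    case empty
    then show ?case using single[of 0 0] by simp
  next
    case (insert m A)
    then show ?case using single add by simp
  qed
  moreover have "f = (\<Sum>m\<in>Poly_Mapping.keys f. Poly_Mapping.single m (Poly_Mapping.lookup f m))"
    by (rule poly_mapping_eqI)
      (auto simp: lookup_sum lookup_single when_def not_in_keys_iff_lookup_eq_zero)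
  ultimately show ?thesis by (metis finite_keys)
qed

definition monomial_value :: "(nat \<Rightarrow> real) \<Rightarrow> (nat \<Rightarrow>\<^sub>0 nat) \<Rightarrow> real" where
  "monomial_value x m = (\<Prod>i\<in>Poly_Mapping.keys m. x i ^ Poly_Mapping.lookup m i)"

lemma monomial_value_superset:
  assumes "finite S" "Poly_Mapping.keys m \<subseteq> S"
  shows "monomial_value x m = (\<Prod>i\<in>S. x i ^ Poly_Mapping.lookup m i)"
  unfolding monomial_value_def
  by (rule prod.mono_neutral_left) (use assms in \<open>auto simp: in_keys_iff\<close>)

lemma monomial_value_add:
  "monomial_value x (m + m') = monomial_value x m * monomial_value x m'"
proof -
  let ?S = "Poly_Mapping.keys m \<union> Poly_Mapping.keys m'"
  have "Poly_Mapping.keys (m + m') \<subseteq> ?S" by (rule keys_add)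
  then show ?thesis
    by (simp add: monomial_value_superset[of ?S] lookup_add power_add prod.distrib)
qed

lemma monomial_value_one [simp]: "monomial_value (\<lambda>_. 1) m = 1"
  by (simp add: monomial_value_def)

text \<open>Monomials are eigenvectors of the scaling of one variable; distinct exponents of that
  variable give distinct eigenvalues, which separates monomials below.\<close>

lemma monomial_value_upd:
  "monomial_value (x(i := t * x i)) m = t ^ Poly_Mapping.lookup m i * monomial_value x m"
proof -
  let ?S = "insert i (Poly_Mapping.keys m)"
  have "monomial_value (x(i := t * x i)) m
      = (t * x i) ^ Poly_Mapping.lookup m i * (\<Prod>j\<in>?S - {i}. x j ^ Poly_Mapping.lookup m j)"
    by (subst monomial_value_superset[of ?S]) (auto simp: prod.remove[of ?S i])
  also have "\<dots> = t ^ Poly_Mapping.lookup m i * monomial_value x m"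
    by (subst monomial_value_superset[of ?S m])
      (auto simp: prod.remove[of ?S i] power_mult_distrib)
  finally show ?thesis .
qed

lemma peval_superset:
  assumes "finite S" "Poly_Mapping.keys f \<subseteq> S"
  shows "peval x f = (\<Sum>m\<in>S. Poly_Mapping.lookup f m * monomial_value x m)"
  unfolding peval_def monomial_value_def
  by (rule sum.mono_neutral_left) (use assms in \<open>auto simp: in_keys_iff\<close>)

lemma peval_add: "peval x (f + g) = peval x f + peval x g"
proof -
  let ?S = "Poly_Mapping.keys f \<union> Poly_Mapping.keys g"
  have "Poly_Mapping.keys (f + g) \<subseteq> ?S" by (rule keys_add)
  then show ?thesis
    by (simp add: peval_superset[of ?S] lookup_add algebra_simps sum.distrib)
qed

lemma peval_single: "peval x (Poly_Mapping.single m c) = c * monomial_value x m"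
  by (subst peval_superset[of "{m}"]) auto

lemma peval_mult: "peval x (f * g) = peval x f * peval x g"
proof (induction f rule: rpoly_monomial_induct)
  case (single m c)
  show ?case
    by (induction g rule: rpoly_monomial_induct)
      (simp_all add: mult_single peval_single peval_add monomial_value_add algebra_simps)
next
  case (add f g)
  then show ?case by (simp add: peval_add algebra_simps)
qed

lemma peval_Cst [simp]: "peval x (Cst r) = r"
  by (simp add: Cst_def peval_single monomial_value_def)

lemma peval_X [simp]: "peval x (X i) = x i"
  by (simp add: X_def peval_single monomial_value_def)

lemma Cst_0 [simp]: "Cst 0 = 0" and Cst_1 [simp]: "Cst 1 = 1"
  by (simp_all add: Cst_def)

lemma Cst_add: "Cst (r + s) = Cst r + Cst s"
  by (simp add: Cst_def single_add)

lemma Cst_mult: "Cst (r * s) = Cst r * Cst s"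
  by (simp add: Cst_def mult_single)

lemma peval_0 [simp]: "peval x 0 = 0" and peval_1 [simp]: "peval x 1 = 1"
  using peval_Cst[of x 0] peval_Cst[of x 1] by simp_all

lemma Cst_eq_0_iff [simp]: "Cst r = 0 \<longleftrightarrow> r = 0"
  by (metis Cst_0 peval_Cst)

interpretation peval: comm_ring_hom "peval x" for x
  by unfold_locales (simp_all add: peval_add peval_mult)

text \<open>Distinct monomials are linearly independent as functions, by the argument that proves
  independence of characters: if two exponents differ in the variable \<open>x\<^sub>i\<close>, then subtracting a
  multiple of a vanishing combination from the one obtained by doubling \<open>x\<^sub>i\<close> yields a shorter
  vanishing combination.\<close>

lemma polynomial_function_eq_0_imp_eq_0:
  fixes f :: rpoly
  assumes "\<And>x. peval x f = 0"
  shows "f = 0"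
proof -
  have "\<forall>m\<in>S. d m = 0"
    if "finite S" "\<And>x. (\<Sum>m\<in>S. d m * monomial_value x m) = 0"
    for S :: "(nat \<Rightarrow>\<^sub>0 nat) set" and d :: "(nat \<Rightarrow>\<^sub>0 nat) \<Rightarrow> real"
    using that
  proof (induction S arbitrary: d)
    case empty
    then show ?case by simp
  next
    case (insert k S)
    have "d m = 0" if m: "m \<in> S" for m
    proof -
      from m insert.hyps have "m \<noteq> k" by auto
      then obtain i where i: "Poly_Mapping.lookup m i \<noteq> Poly_Mapping.lookup k i"
        by (meson poly_mapping_eqI)
      let ?e = "\<lambda>m. (2::real) ^ Poly_Mapping.lookup m i - 2 ^ Poly_Mapping.lookup k i"
      have "(\<Sum>m\<in>S. (d m * ?e m) * monomial_value x m) = 0" for x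
      proof -
        have "(\<Sum>m\<in>insert k S. (d m * ?e m) * monomial_value x m)
            = (\<Sum>m\<in>insert k S. d m * monomial_value (x(i := 2 * x i)) m)
              - 2 ^ Poly_Mapping.lookup k i * (\<Sum>m\<in>insert k S. d m * monomial_value x m)"
          unfolding monomial_value_upd sum_distrib_left sum_subtractf[symmetric]
          by (rule sum.cong) (auto simp: algebra_simps)
        also have "\<dots> = 0" by (simp only: insert.prems)
        finally show ?thesis using insert.hyps by simp
      qed
      then have "d m * ?e m = 0" using insert.IH[of "\<lambda>m. d m * ?e m"] m by blast
      with i show "d m = 0" by simp
    qed
    moreover from this have "d k = 0"
      using insert.prems[of "\<lambda>_. 1"] insert.hyps by simp
    ultimately show ?case by auto
  qed
  from this[of "Poly_Mapping.keys f" "Poly_Mapping.lookup f"] assms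
  have "\<forall>m\<in>Poly_Mapping.keys f. Poly_Mapping.lookup f m = 0"
    by (simp add: peval_superset[symmetric])
  then show ?thesis by (metis in_keys_iff keys_eq_empty ex_in_conv)
qed

section \<open>Derivatives and vector fields\<close>

lemma partial_superset:
  assumes "finite S" "Poly_Mapping.keys f \<subseteq> S"
  shows "partial i f = (\<Sum>m\<in>S. Poly_Mapping.single (m - Poly_Mapping.single i 1)
       (real (Poly_Mapping.lookup m i) * Poly_Mapping.lookup f m))"
  unfolding partial_def
  by (rule sum.mono_neutral_left) (use assms in \<open>auto simp: in_keys_iff\<close>)

lemma partial_add: "partial i (f + g) = partial i f + partial i g"
proof -
  let ?S = "Poly_Mapping.keys f \<union> Poly_Mapping.keys g"
  have "Poly_Mapping.keys (f + g) \<subseteq> ?S" by (rule keys_add)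
  then show ?thesis
    by (simp add: partial_superset[of ?S] lookup_add algebra_simps sum.distrib single_add)
qed

lemma partial_single:
  "partial i (Poly_Mapping.single m c) =
    Poly_Mapping.single (m - Poly_Mapping.single i 1) (real (Poly_Mapping.lookup m i) * c)"
  by (subst partial_superset[of "{m}"]) auto

text \<open>Exponents are subtracted with truncation, so this fails without positivity. In the Leibniz
  rule the terms with exponent 0 drop out because their coefficients vanish.\<close>

lemma exponent_diff_add:
  assumes "Poly_Mapping.lookup m i > 0"
  shows "m - Poly_Mapping.single i 1 + k = m + k - Poly_Mapping.single i (1::nat)"
  by (rule poly_mapping_eqI)
    (use assms in \<open>auto simp: lookup_add lookup_minus lookup_single when_def\<close>)

lemma partial_mult: "partial i (f * g) = partial i f * g + f * partial i g"
proof (induction f rule: rpoly_monomial_induct)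
  case (single m c)
  show ?case
  proof (induction g rule: rpoly_monomial_induct)
    case (single k d)
    let ?e = "m + k - Poly_Mapping.single i (1::nat)"
    have "partial i (Poly_Mapping.single m c) * Poly_Mapping.single k d
        = Poly_Mapping.single ?e (real (Poly_Mapping.lookup m i) * (c * d))"
      using exponent_diff_add[of m i k]
      by (cases "Poly_Mapping.lookup m i > 0")
        (auto simp: partial_single mult_single ac_simps)
    moreover have "Poly_Mapping.single m c * partial i (Poly_Mapping.single k d)
        = Poly_Mapping.single ?e (real (Poly_Mapping.lookup k i) * (c * d))"
      using exponent_diff_add[of k i m]
      by (cases "Poly_Mapping.lookup k i > 0")
        (auto simp: partial_single mult_single ac_simps)
    ultimately show ?case
      by (simp add: mult_single partial_single lookup_add algebra_simps flip: single_add)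
  qed (simp add: partial_add algebra_simps)
next
  case (add f h)
  then show ?case by (simp add: partial_add algebra_simps)
qed

lemma partial_Cst [simp]: "partial i (Cst r) = 0"
  by (simp add: Cst_def partial_single)

lemma partial_X [simp]: "partial i (X j) = (if i = j then 1 else 0)"
  by (simp add: X_def partial_single lookup_single when_def)

lemma partial_0 [simp]: "partial i 0 = 0" and partial_1 [simp]: "partial i 1 = 0"
  using partial_Cst[of i 0] partial_Cst[of i 1] by simp_all

lemma partial_diff: "partial i (f - g) = partial i f - partial i g"
  using partial_add[of i "f - g" g] by simp

lemma partial_sum: "partial i (sum f A) = (\<Sum>a\<in>A. partial i (f a))"
  by (induction A rule: infinite_finite_induct) (simp_all add: partial_add)

lemma vf_apply_add: "vf_apply n R (f + g) = vf_apply n R f + vf_apply n R g"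
  by (simp add: vf_apply_def partial_add algebra_simps sum.distrib)

lemma vf_apply_0 [simp]: "vf_apply n R 0 = 0"
  by (simp add: vf_apply_def)

lemma vf_apply_Cst_mult: "vf_apply n R (Cst r * f) = Cst r * vf_apply n R f"
  by (simp add: vf_apply_def partial_mult sum_distrib_left ac_simps)

lemma vf_apply_sum: "vf_apply n R (sum f A) = (\<Sum>a\<in>A. vf_apply n R (f a))"
  by (induction A rule: infinite_finite_induct) (simp_all add: vf_apply_add)

lemma vf_apply_X: "i \<in> {1..n} \<Longrightarrow> vf_apply n R (X i) = R i"
  by (simp add: vf_apply_def if_distrib cong: if_cong)

lemma funpow_vf_apply_lincomb:
  assumes "finite A"
  shows "(vf_apply n R ^^ r) (\<Sum>a\<in>A. Cst (w a) * f a)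
    = (\<Sum>a\<in>A. Cst (w a) * (vf_apply n R ^^ r) (f a))"
  by (induction r) (simp_all add: vf_apply_sum vf_apply_Cst_mult)

section \<open>Linear forms\<close>

definition linform :: "nat \<Rightarrow> (nat \<Rightarrow> real) \<Rightarrow> rpoly" where
  "linform m b = (\<Sum>i=1..m. Cst (b i) * X i)"

lemma W_space_eq: "W_space p = range (linform (p + 1))"
  by (auto simp: W_space_def linform_def)

lemma linform_cong: "(\<And>i. i \<in> {1..m} \<Longrightarrow> b i = b' i) \<Longrightarrow> linform m b = linform m b'"
  unfolding linform_def by (intro sum.cong) auto

lemma Cst_sum: "Cst (sum f A) = (\<Sum>a\<in>A. Cst (f a))"
  by (induction A rule: infinite_finite_induct) (simp_all add: Cst_add)

lemma Cst_mult_linform: "Cst k * linform m b = linform m (\<lambda>i. k * b i)"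
  by (simp add: linform_def sum_distrib_left Cst_mult mult.assoc)

lemma peval_linform [simp]: "peval x (linform m b) = (\<Sum>i=1..m. b i * x i)"
  by (simp add: linform_def peval.hom_sum peval_mult)

lemma partial_linform: "i \<in> {1..m} \<Longrightarrow> partial i (linform m b) = Cst (b i)"
  by (simp add: linform_def partial_sum partial_mult if_distrib cong: if_cong)

lemma linform_eq_0_iff: "linform m b = 0 \<longleftrightarrow> (\<forall>i\<in>{1..m}. b i = 0)"
proof
  assume "linform m b = 0"
  then show "\<forall>i\<in>{1..m}. b i = 0"
    by (metis partial_linform partial_0 Cst_eq_0_iff)
next
  assume "\<forall>i\<in>{1..m}. b i = 0"
  then show "linform m b = 0" by (simp add: linform_def)
qed

lemma vf_apply_linform:
  assumes "m \<le> n" and R: "\<And>i. i \<in> {1..m} \<Longrightarrow> R i = linform m (c i)"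
  shows "vf_apply n R (linform m b) = linform m (\<lambda>j. \<Sum>i=1..m. b i * c i j)"
proof -
  have "vf_apply n R (linform m b) = (\<Sum>i=1..m. Cst (b i) * R i)"
    using assms(1) by (simp add: linform_def vf_apply_sum vf_apply_Cst_mult vf_apply_X)
  also have "\<dots> = (\<Sum>i=1..m. \<Sum>j=1..m. Cst (b i * c i j) * X j)"
    by (rule sum.cong) (simp_all add: R linform_def sum_distrib_left Cst_mult mult.assoc)
  also have "\<dots> = linform m (\<lambda>j. \<Sum>i=1..m. b i * c i j)"
    by (subst sum.swap) (simp add: linform_def Cst_sum sum_distrib_right)
  finally show ?thesis .
qed

section \<open>The extactic determinant\<close>

definition extactic_mat :: "nat \<Rightarrow> nat \<Rightarrow> (nat \<Rightarrow> rpoly) \<Rightarrow> rpoly mat" where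
  "extactic_mat n m R = mat m m (\<lambda>(r, s). (vf_apply n R ^^ r) (X (s + 1)))"

lemma extactic_mat_carrier [simp]: "extactic_mat n m R \<in> carrier_mat m m"
  by (simp add: extactic_mat_def)

lemma extactic_eq_det: "extactic p q R = det (extactic_mat (p + q + 1) (p + 1) R)"
  by (simp add: extactic_def extactic_mat_def)

text \<open>Row \<open>r\<close> of the extactic matrix holds the \<open>r\<close>-th iterates of the coordinates, so pairing it
  with constants is iterating on the linear form that they define.\<close>

lemma extactic_mat_row_sum:
  assumes "r < m"
  shows "(\<Sum>s<m. extactic_mat n m R $$ (r, s) * Cst (b (s + 1)))
    = (vf_apply n R ^^ r) (linform m b)"
proof -
  have "(vf_apply n R ^^ r) (linform m b) = (\<Sum>s=1..m. Cst (b s) * (vf_apply n R ^^ r) (X s))"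
    by (simp add: linform_def funpow_vf_apply_lincomb)
  also have "\<dots> = (\<Sum>s<m. extactic_mat n m R $$ (r, s) * Cst (b (s + 1)))"
    unfolding One_nat_def sum.atLeast1_atMost_eq
    by (rule sum.cong) (use assms in \<open>simp_all add: extactic_mat_def mult.commute\<close>)
  finally show ?thesis by simp
qed

lemma funpow_vf_apply_first_integral:
  assumes "vf_apply n R f = 0"
  shows "(vf_apply n R ^^ r) f = (if r = 0 then f else 0)"
  by (induction r) (use assms in auto)

text \<open>The extactic matrix sends the coefficient vector of a linear first integral \<open>g\<close> to
  \<open>(g, 0, \<dots>, 0)\<close>. For two of them, the combination \<open>d\<close> below of the coefficient vectors, with
  polynomial weights, is therefore in the kernel, which is trivial.\<close>

lemma linear_first_integrals_proportional:
  assumes det: "det (extactic_mat n m R) \<noteq> 0"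
    and b: "vf_apply n R (linform m b) = 0" and b': "vf_apply n R (linform m b') = 0"
    and "i \<in> {1..m}"
  shows "Cst (b i) * linform m b' = Cst (b' i) * linform m b"
proof -
  let ?M = "extactic_mat n m R" and ?g = "linform m b" and ?g' = "linform m b'"
  define d where "d = vec m (\<lambda>s. Cst (b (s + 1)) * ?g' - Cst (b' (s + 1)) * ?g)"
  have "?M *\<^sub>v d = 0\<^sub>v m"
  proof (rule eq_vecI)
    fix r assume r: "r < dim_vec (0\<^sub>v m :: rpoly vec)"
    then have "(?M *\<^sub>v d) $ r = (\<Sum>s<m. ?M $$ (r, s) * d $ s)"
      by (simp add: extactic_mat_def scalar_prod_def d_def lessThan_atLeast0)
    also have "\<dots> = (\<Sum>s<m. ?M $$ (r, s) * Cst (b (s + 1))) * ?g'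
        - (\<Sum>s<m. ?M $$ (r, s) * Cst (b' (s + 1))) * ?g"
      by (simp add: d_def right_diff_distrib sum_subtractf sum_distrib_right mult.assoc)
    also have "\<dots> = 0"
      using r by (simp only: extactic_mat_row_sum index_zero_vec
          funpow_vf_apply_first_integral[OF b] funpow_vf_apply_first_integral[OF b']) simp
    finally show "(?M *\<^sub>v d) $ r = 0\<^sub>v m $ r" using r by simp
  qed (simp add: extactic_mat_def)
  moreover have "d \<in> carrier_vec m" by (simp add: d_def)
  ultimately have "d = 0\<^sub>v m"
    using det det_0_iff_vec_prod_zero[OF extactic_mat_carrier[of n m R]] by blast
  moreover obtain s where "i = s + 1" "s < m"
    using \<open>i \<in> {1..m}\<close> by (cases i) auto
  ultimately have "d $ s = 0" by simp
  with \<open>i = s + 1\<close> \<open>s < m\<close> show ?thesis by (simp add: d_def)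
qed

text \<open>Cramer's rule for the system \<open>M b = (g, 0, \<dots>, 0)\<close>.\<close>

lemma extactic_mat_det_eq_cofactor:
  assumes b: "vf_apply n R (linform m b) = 0" and j: "j < m"
  shows "det (extactic_mat n m R) * Cst (b (j + 1))
    = cofactor (extactic_mat n m R) 0 j * linform m b"
proof -
  let ?M = "extactic_mat n m R"
  let ?v = "vec m (\<lambda>s. Cst (b (s + 1)))"
  let ?w = "vec m (\<lambda>r. if r = 0 then linform m b else 0)"
  note adj = adj_mat[OF extactic_mat_carrier[of n m R]]
  have w: "?M *\<^sub>v ?v = ?w"
  proof (rule eq_vecI)
    fix r assume r: "r < dim_vec ?w"
    then have "(?M *\<^sub>v ?v) $ r = (\<Sum>s<m. ?M $$ (r, s) * Cst (b (s + 1)))"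
      by (simp add: extactic_mat_def scalar_prod_def lessThan_atLeast0)
    then show "(?M *\<^sub>v ?v) $ r = ?w $ r"
      using r by (simp add: extactic_mat_row_sum[simplified] funpow_vf_apply_first_integral[OF b])
  qed (simp add: extactic_mat_def)
  have "det ?M * Cst (b (j + 1)) = ((det ?M \<cdot>\<^sub>m 1\<^sub>m m) *\<^sub>v ?v) $ j"
    using j by (simp add: scalar_prod_def if_distrib if_distribR cong: if_cong)
  also have "\<dots> = (adj_mat ?M *\<^sub>v ?w) $ j"
    unfolding w[symmetric] adj(3)[symmetric]
    by (subst assoc_mult_mat_vec[OF adj(1) extactic_mat_carrier]) simp_all
  also have "\<dots> = (\<Sum>k\<in>{0..<m}. adj_mat ?M $$ (j, k) * (if k = 0 then linform m b else 0))"
    using j adj(1) by (simp add: scalar_prod_def)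
  also have "\<dots> = adj_mat ?M $$ (j, 0) * linform m b"
    using j by (simp add: if_distrib cong: if_cong)
  also have "adj_mat ?M $$ (j, 0) = cofactor ?M 0 j"
    using j by (simp add: adj_mat_def extactic_mat_def)
  finally show ?thesis .
qed

text \<open>Each iterate of a coordinate is a linear form, and applying the field to the linear form
  \<open>l \<cdot> y\<close> gives \<open>l \<cdot> c y\<close>, which does not change along a direction \<open>b\<close> in the kernel of \<open>c\<close>.\<close>

lemma iterate_translation_invariant:
  assumes "m \<le> n" and R: "\<And>i. i \<in> {1..m} \<Longrightarrow> R i = linform m (c i)"
    and ker: "\<And>i. i \<in> {1..m} \<Longrightarrow> (\<Sum>j=1..m. c i j * b j) = 0"
    and "i \<in> {1..m}" and "r > 0"
  shows "peval (\<lambda>i. x i + t * b i) ((vf_apply n R ^^ r) (X i)) = peval x ((vf_apply n R ^^ r) (X i))"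
proof -
  have app: "vf_apply n R (linform m l) = linform m (\<lambda>j. \<Sum>h=1..m. l h * c h j)" for l
    by (rule vf_apply_linform[OF assms(1) R])
  have lin: "\<exists>l. (vf_apply n R ^^ k) (X i) = linform m l" for k
  proof (induction k)
    case 0
    have "X i = linform m (\<lambda>j. if j = i then 1 else 0)"
      using \<open>i \<in> {1..m}\<close> by (simp add: linform_def if_distrib if_distribR cong: if_cong)
    then show ?case by auto
  next
    case (Suc k)
    then show ?case using app by auto
  qed
  obtain k where k: "r = Suc k" using \<open>r > 0\<close> by (cases r) auto
  from lin[of k] obtain l where l: "(vf_apply n R ^^ k) (X i) = linform m l" by blast
  have "(\<Sum>j=1..m. (\<Sum>h=1..m. l h * c h j) * b j) = (\<Sum>h=1..m. l h * (\<Sum>j=1..m. c h j * b j))"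
    unfolding sum_distrib_left sum_distrib_right by (subst sum.swap) (simp add: mult.assoc)
  also have "\<dots> = 0" using ker by simp
  finally have "(\<Sum>j=1..m. (\<Sum>h=1..m. l h * c h j) * (t * b j)) = 0"
    unfolding mult.left_commute[of _ t] sum_distrib_left[symmetric] by simp
  then show ?thesis
    by (simp add: k l app distrib_left sum.distrib)
qed

text \<open>If the square of \<open>g = b \<cdot> y\<close> divided the determinant, then \<open>g\<close> would divide the cofactors of
  the first row, by Cramer's rule. The minors defining them avoid the first row, so the cofactors
  are constant along \<open>b\<close>; as every line in this direction meets the hyperplane \<open>g = 0\<close>, they
  would vanish.\<close>

lemma extactic_not_divisible_by_square:
  assumes "m \<le> n" and R: "\<And>i. i \<in> {1..m} \<Longrightarrow> R i = linform m (c i)"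
    and ker: "\<And>i. i \<in> {1..m} \<Longrightarrow> (\<Sum>j=1..m. c i j * b j) = 0"
    and int: "vf_apply n R (linform m b) = 0"
    and nz: "linform m b \<noteq> 0"
    and det: "det (extactic_mat n m R) \<noteq> 0"
  shows "\<not> linform m b ^ 2 dvd det (extactic_mat n m R)"
proof
  let ?M = "extactic_mat n m R" and ?g = "linform m b"
  assume "?g ^ 2 dvd det ?M"
  then obtain F where F: "det ?M = ?g ^ 2 * F" by (elim dvdE)
  obtain i where i: "i \<in> {1..m}" "b i \<noteq> 0" using nz by (auto simp: linform_eq_0_iff)
  define j where "j = i - 1"
  have j: "j < m" "b (j + 1) \<noteq> 0" using i by (auto simp: j_def)
  let ?C = "cofactor ?M 0 j"
  have "?g * ?C = ?g * (?g * F * Cst (b (j + 1)))"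
    using extactic_mat_det_eq_cofactor[OF int j(1), symmetric]
    unfolding F power2_eq_square by (simp only: mult_ac)
  then have C: "?C = ?g * F * Cst (b (j + 1))" using nz by (metis mult_cancel_left)
  have inv: "peval (\<lambda>i. x i + t * b i) ?C = peval x ?C" for x t
  proof -
    have *: "map_mat (peval (\<lambda>i. x i + t * b i)) (mat_delete ?M 0 j)
        = map_mat (peval x) (mat_delete ?M 0 j)"
      by (rule eq_matI)
        (auto simp: mat_delete_def extactic_mat_def simp del: funpow.simps
          intro!: iterate_translation_invariant[OF assms(1) R ker])
    show ?thesis
      unfolding cofactor_def peval.hom_mult peval.hom_det[symmetric] *
      by (simp add: peval.hom_power peval.hom_uminus)
  qed
  have pos: "(\<Sum>i=1..m. b i * b i) \<noteq> 0"
    using i by (subst sum_nonneg_eq_0_iff) auto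
  have "?C = 0"
  proof (rule polynomial_function_eq_0_imp_eq_0)
    fix x
    \<comment> \<open>Moving from \<open>x\<close> by \<open>t\<close> in the direction \<open>b\<close> reaches the hyperplane.\<close>
    define t where "t = - peval x ?g / (\<Sum>i=1..m. b i * b i)"
    have "peval (\<lambda>i. x i + t * b i) ?g = peval x ?g + t * (\<Sum>i=1..m. b i * b i)"
      by (simp add: algebra_simps sum.distrib sum_distrib_left)
    also have "\<dots> = 0" using pos by (simp add: t_def)
    finally have "peval (\<lambda>i. x i + t * b i) ?C = 0"
      unfolding C peval_mult by simp
    then show "peval x ?C = 0" using inv by simp
  qed
  then show False
    using extactic_mat_det_eq_cofactor[OF int j(1)] det j(2) by simp
qed

section \<open>Affine vector fields tangent to the hypersurface\<close>

lemma peval_S_poly: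
  "peval x (S_poly p q a)
    = ((\<Sum>i=1..p+1. x i ^ 2) - a ^ 2) ^ 2 + (\<Sum>j=p+2..p+q+1. x j ^ 2) - 1"
  by (simp add: S_poly_def peval.hom_sum peval.hom_add peval.hom_minus peval.hom_power)

lemma partial_square: "partial i (f ^ 2) = 2 * f * partial i f"
  by (simp add: power2_eq_square partial_mult)

lemma peval_partial_S_poly:
  assumes "i \<in> {1..p+q+1}"
  shows "peval x (partial i (S_poly p q a))
    = (if i \<le> p + 1 then 4 * ((\<Sum>i=1..p+1. x i ^ 2) - a ^ 2) * x i else 2 * x i)"
proof -
  have sum: "partial i (\<Sum>j\<in>A. X j ^ 2) = (if i \<in> A then 2 * X i else 0)" if "finite A" for A
    using that by (simp add: partial_sum partial_square if_distrib cong: if_cong)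
  have num: "peval x (numeral k) = numeral k" for k
    by (metis peval.hom_numeral)
  show ?thesis
    using assms
    by (auto simp: S_poly_def partial_add partial_diff partial_square sum num peval.hom_sum
        peval.hom_add peval.hom_minus peval.hom_power peval_mult simp del: sum.cl_ivl_Suc)
qed

text \<open>On \<open>S\<close> the right-hand side \<open>K h\<close> of the invariance equation vanishes, whatever the
  cofactor \<open>K\<close> is. What is left is the inner product of the field with the gradient of \<open>h\<close>.\<close>

lemma tangent_at_S:
  assumes "vf_defined_on_S p q a R" and "peval x (S_poly p q a) = 0"
  shows "(\<Sum>i=1..p+q+1. peval x (R i) *
      (if i \<le> p + 1 then 4 * ((\<Sum>i=1..p+1. x i ^ 2) - a ^ 2) * x i else 2 * x i)) = 0"
proof -
  from assms(1) obtain K where "vf_apply (p+q+1) R (S_poly p q a) = K * S_poly p q a"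
    by (auto simp: vf_defined_on_S_def vf_invariant_def)
  then have "peval x (vf_apply (p+q+1) R (S_poly p q a)) = 0"
    using assms(2) by (simp add: peval_mult)
  then show ?thesis
    by (simp add: vf_apply_def peval.hom_sum peval_mult peval_partial_S_poly del: sum.cl_ivl_Suc)
qed

lemma sum_two_support:
  fixes f :: "nat \<Rightarrow> real"
  assumes "finite A" "k \<noteq> l" "\<And>i. i \<in> A \<Longrightarrow> i \<noteq> k \<Longrightarrow> i \<noteq> l \<Longrightarrow> f i = 0"
  shows "sum f A = (if k \<in> A then f k else 0) + (if l \<in> A then f l else 0)"
proof -
  have "sum f A = sum f (A \<inter> {k, l})"
    by (rule sum.mono_neutral_right) (use assms in auto)
  also have "A \<inter> {k, l} = (if k \<in> A then {k} else {}) \<union> (if l \<in> A then {l} else {})"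
    by auto
  finally show ?thesis using assms(2) by auto
qed

locale affine_field_tangent_to_S =
  fixes p q n :: nat and a :: real and R :: "nat \<Rightarrow> rpoly" and c :: "nat \<Rightarrow> nat \<Rightarrow> real"
  assumes p: "p > 0" and n: "n = p + q + 1" and a: "a > 0"
    and R: "\<And>i. i \<in> {1..n} \<Longrightarrow> R i = (\<Sum>j=1..n. Cst (c i j) * X j) + Cst (c i 0)"
    and tangent: "vf_defined_on_S p q a R"
begin

text \<open>Points with two nonzero coordinates suffice to determine the coefficients. The point has
  the entries \<open>\<alpha>\<close> and \<open>\<beta>\<close> at the positions \<open>k\<close> and \<open>l\<close>; the hypothesis \<open>S\<close> puts it on the
  hypersurface, on the outermost sphere \<open>z = 0\<close>, \<open>|y|\<^sup>2 = a\<^sup>2 + 1\<close> if both positions are in the first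
  block.\<close>

lemma tangent_two_coordinates:
  assumes kl: "k \<in> {1..p+1}" "l \<in> {1..n}" "k \<noteq> l"
    and S: "if l \<le> p + 1 then \<alpha>\<^sup>2 + \<beta>\<^sup>2 = a\<^sup>2 + 1 else (\<alpha>\<^sup>2 - a\<^sup>2)\<^sup>2 + \<beta>\<^sup>2 = 1"
  shows "(if l \<le> p + 1 then 4 else 4 * (\<alpha>\<^sup>2 - a\<^sup>2)) * \<alpha> * (c k k * \<alpha> + c k l * \<beta> + c k 0)
    + (if l \<le> p + 1 then 4 else 2) * \<beta> * (c l k * \<alpha> + c l l * \<beta> + c l 0) = 0"
proof -
  define x where "x = (\<lambda>i. if i = k then \<alpha> else if i = l then \<beta> else 0)"
  have x: "x k = \<alpha>" "x l = \<beta>" "\<And>i. i \<noteq> k \<Longrightarrow> i \<noteq> l \<Longrightarrow> x i = 0"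
    using kl by (auto simp: x_def)
  have Rx: "peval x (R i) = c i k * \<alpha> + c i l * \<beta> + c i 0" if "i \<in> {1..n}" for i
  proof -
    have "peval x (R i) = (\<Sum>j=1..n. c i j * x j) + c i 0"
      using that by (simp add: R peval.hom_add peval.hom_sum peval_mult)
    also have "(\<Sum>j=1..n. c i j * x j) = c i k * \<alpha> + c i l * \<beta>"
      using kl n by (subst sum_two_support[of _ k l]) (auto simp: x)
    finally show ?thesis .
  qed
  have s: "(\<Sum>i=1..p+1. x i ^ 2) = \<alpha>\<^sup>2 + (if l \<le> p + 1 then \<beta>\<^sup>2 else 0)"
    using kl by (subst sum_two_support[of _ k l]) (auto simp: x)
  have z: "(\<Sum>j=p+2..p+q+1. x j ^ 2) = (if l \<le> p + 1 then 0 else \<beta>\<^sup>2)"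
    using kl n by (subst sum_two_support[of _ k l]) (auto simp: x)
  have on_S: "peval x (S_poly p q a) = 0"
    using S unfolding peval_S_poly s z by (auto split: if_splits)
  have w: "\<alpha>\<^sup>2 + (if l \<le> p + 1 then \<beta>\<^sup>2 else 0) - a\<^sup>2 = (if l \<le> p + 1 then 1 else \<alpha>\<^sup>2 - a\<^sup>2)"
    using S by (auto split: if_splits)
  from tangent_at_S[OF tangent on_S, folded n]
  have "(\<Sum>i=1..n. peval x (R i) * (if i \<le> p + 1 then
      4 * (if l \<le> p + 1 then 1 else \<alpha>\<^sup>2 - a\<^sup>2) * x i else 2 * x i)) = 0"
    unfolding s w .
  then show ?thesis
    using kl n
    by (subst (asm) sum_two_support[of _ k l]) (auto simp: x Rx algebra_simps split: if_splits)
qed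

text \<open>At the antipodal points \<open>\<plusminus> r e\<^sub>k\<close> of the sphere \<open>z = 0\<close>, \<open>|y|\<^sup>2 = a\<^sup>2 + 1\<close> the linear and the
  constant term of \<open>R\<^sub>k\<close> enter with opposite relative signs.\<close>

lemma diagonal_and_constant_vanish:
  assumes k: "k \<in> {1..p+1}"
  shows "c k k = 0" and "c k 0 = 0"
proof -
  obtain l where l: "l \<in> {1..p+1}" "l \<noteq> k"
    using p k by (cases "k = 1") (auto intro: that[of 1] that[of 2])
  define r where "r = sqrt (a\<^sup>2 + 1)"
  have r: "r > 0" "r\<^sup>2 = a\<^sup>2 + 1" by (auto simp: r_def add_nonneg_pos)
  have "c k k * r + c k 0 = 0"
    using tangent_two_coordinates[of k l r 0] k l n r by auto
  moreover have "c k k * (- r) + c k 0 = 0"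
    using tangent_two_coordinates[of k l "- r" 0] k l n r by auto
  ultimately have "c k k * r = 0" "c k 0 = 0" by linarith+
  with r show "c k k = 0" "c k 0 = 0" by auto
qed

lemma skew_symmetric:
  assumes k: "k \<in> {1..p+1}" and l: "l \<in> {1..p+1}"
  shows "c k l = - c l k"
proof (cases "k = l")
  case False
  define r where "r = sqrt ((a\<^sup>2 + 1) / 2)"
  have r: "r > 0" "r\<^sup>2 = (a\<^sup>2 + 1) / 2" by (auto simp: r_def add_nonneg_pos)
  have "4 * r * (c k l * r) + 4 * r * (c l k * r) = 0"
    using tangent_two_coordinates[of k l r r] k l n r False
      diagonal_and_constant_vanish[OF k] diagonal_and_constant_vanish[OF l] by auto
  then have "4 * r * r * (c k l + c l k) = 0" by (simp add: algebra_simps)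
  with r show ?thesis by simp
qed (use diagonal_and_constant_vanish k in simp)

lemma no_transversal_coupling:
  assumes k: "k \<in> {1..p+1}" and l: "l \<in> {p+2..n}"
  shows "c k l = 0"
proof -
  have T: "4 * (\<alpha>\<^sup>2 - a\<^sup>2) * \<alpha> * (c k l * \<beta>) + 2 * \<beta> * (c l k * \<alpha> + c l l * \<beta> + c l 0) = 0"
    if "(\<alpha>\<^sup>2 - a\<^sup>2)\<^sup>2 + \<beta>\<^sup>2 = 1" for \<alpha> \<beta>
    using tangent_two_coordinates[of k l \<alpha> \<beta>] that k l n
      diagonal_and_constant_vanish[OF k] by auto
  \<comment> \<open>Where \<open>|y| = a\<close>, the gradient of \<open>h\<close> has no component in the first block.\<close>
  have "c l k * a + c l l + c l 0 = 0" "c l k * (- a) + c l l + c l 0 = 0"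
    using T[of a 1] T[of "- a" 1] by auto
  then have "c l k * a = 0" by linarith
  with a have lk: "c l k = 0" by simp
  \<comment> \<open>A rational point of the unit circle with both coordinates nonzero: \<open>(3/5)\<^sup>2 + (4/5)\<^sup>2 = 1\<close>.\<close>
  define r where "r = sqrt (a\<^sup>2 + 3 / 5)"
  have r: "r > 0" "r\<^sup>2 = a\<^sup>2 + 3 / 5" by (auto simp: r_def add_nonneg_pos)
  have "4 * (3 / 5) * r * (c k l * (4 / 5)) + 2 * (4 / 5) * (c l l * (4 / 5) + c l 0) = 0"
    using T[of r "4 / 5"] r lk by (simp add: power2_eq_square)
  moreover have "4 * (3 / 5) * (- r) * (c k l * (4 / 5)) + 2 * (4 / 5) * (c l l * (4 / 5) + c l 0) = 0"
    using T[of "- r" "4 / 5"] r lk by (simp add: power2_eq_square)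
  ultimately have "r * c k l = 0" by linarith
  with r show ?thesis by simp
qed

lemma block_linear:
  assumes k: "k \<in> {1..p+1}"
  shows "R k = linform (p + 1) (c k)"
proof -
  have "R k = (\<Sum>j=1..n. Cst (c k j) * X j)"
    using R[of k] k n diagonal_and_constant_vanish[OF k] by simp
  also have "\<dots> = (\<Sum>j=1..p+1. Cst (c k j) * X j)"
    by (rule sum.mono_neutral_right) (use n no_transversal_coupling[OF k] in auto)
  finally show ?thesis by (simp add: linform_def)
qed

text \<open>By skew-symmetry the field maps \<open>b \<cdot> y\<close> to \<open>- (A b) \<cdot> y\<close>, and \<open>b \<cdot> A b = 0\<close>. So evaluating
  the invariance equation at \<open>A b\<close> kills the cofactor and leaves \<open>|A b|\<^sup>2 = 0\<close>.\<close>

lemma invariant_linform_in_kernel: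
  assumes "vf_invariant n R (linform (p + 1) b)"
  shows "\<And>i. i \<in> {1..p+1} \<Longrightarrow> (\<Sum>j=1..p+1. c i j * b j) = 0"
    and "vf_apply n R (linform (p + 1) b) = 0"
proof -
  define y where "y = (\<lambda>i. \<Sum>j=1..p+1. c i j * b j)"
  have "(\<Sum>i=1..p+1. b i * c i j) = - y j" if "j \<in> {1..p+1}" for j
    unfolding y_def sum_negf[symmetric]
  proof (rule sum.cong[OF refl])
    fix i assume "i \<in> {1..p+1}"
    then have "c i j = - c j i" using that by (rule skew_symmetric)
    then show "b i * c i j = - (c j i * b i)" by simp
  qed
  then have "linform (p + 1) (\<lambda>j. \<Sum>i=1..p+1. b i * c i j) = linform (p + 1) (\<lambda>j. - y j)"
    by (rule linform_cong)
  moreover have "vf_apply n R (linform (p + 1) b) = linform (p + 1) (\<lambda>j. \<Sum>i=1..p+1. b i * c i j)"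
    by (rule vf_apply_linform) (use n block_linear in auto)
  ultimately have app: "vf_apply n R (linform (p + 1) b) = linform (p + 1) (\<lambda>j. - y j)"
    by simp
  have "(\<Sum>i=1..p+1. b i * y i) = (\<Sum>i=1..p+1. \<Sum>j=1..p+1. b i * c i j * b j)"
    by (simp add: y_def sum_distrib_left mult.assoc del: sum.cl_ivl_Suc)
  also have "\<dots> = (\<Sum>i=1..p+1. \<Sum>j=1..p+1. - (b j * c j i * b i))"
  proof (intro sum.cong refl)
    fix i j assume "i \<in> {1..p+1}" "j \<in> {1..p+1}"
    then have "c i j = - c j i" by (rule skew_symmetric)
    then show "b i * c i j * b j = - (b j * c j i * b i)" by simp
  qed
  also have "\<dots> = - (\<Sum>i=1..p+1. \<Sum>j=1..p+1. b i * c i j * b j)"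
    by (subst sum.swap) (simp add: sum_negf del: sum.cl_ivl_Suc)
  also have "(\<Sum>i=1..p+1. \<Sum>j=1..p+1. b i * c i j * b j) = (\<Sum>i=1..p+1. b i * y i)"
    by (simp add: y_def sum_distrib_left mult.assoc del: sum.cl_ivl_Suc)
  finally have "peval y (linform (p + 1) b) = 0" by simp
  with assms app have "peval y (linform (p + 1) (\<lambda>j. - y j)) = 0"
    by (metis mult_zero_right peval_mult vf_invariant_def)
  then have "(\<Sum>i=1..p+1. y i * y i) = 0" by (simp add: sum_negf)
  then have y0: "\<And>i. i \<in> {1..p+1} \<Longrightarrow> y i = 0"
    by (subst (asm) sum_nonneg_eq_0_iff) auto
  then show "\<And>i. i \<in> {1..p+1} \<Longrightarrow> (\<Sum>j=1..p+1. c i j * b j) = 0" by (simp add: y_def)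
  show "vf_apply n R (linform (p + 1) b) = 0"
    unfolding app linform_eq_0_iff using y0 by simp
qed

end

section \<open>Meridians and their multiplicities\<close>

text \<open>The vector \<open>v\<close> below is the part of \<open>b'\<close> orthogonal to \<open>b\<close>. Scaled to length \<open>a\<close> and completed
  by a unit vector in the second block, it is a point of the first meridian; if it is on the
  second one as well, then \<open>|v|\<^sup>2 = b' \<cdot> v = 0\<close>.\<close>

lemma meridian_subset_imp_proportional:
  assumes q: "q > 0" and a: "a > 0" and nz: "linform (p + 1) b \<noteq> 0"
    and sub: "meridian p q a (linform (p + 1) b) \<subseteq> meridian p q a (linform (p + 1) b')"
  obtains k where "linform (p + 1) b' = Cst k * linform (p + 1) b"
proof -
  let ?dot = "\<lambda>u v. \<Sum>i=1..p+1. u i * v i :: real"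
  define N where "N = ?dot b b"
  have N: "N \<noteq> 0"
    unfolding N_def using nz by (subst sum_nonneg_eq_0_iff) (auto simp: linform_eq_0_iff)
  define D where "D = ?dot b b' / N"
  define v where "v = (\<lambda>i. b' i - D * b i)"
  have bv: "?dot b v = 0"
  proof -
    have "?dot b v = ?dot b b' - D * ?dot b b"
      unfolding v_def sum_distrib_left sum_subtractf[symmetric]
      by (rule sum.cong) (simp_all add: algebra_simps)
    then show ?thesis using N by (simp add: D_def N_def)
  qed
  have "v i = 0" if "i \<in> {1..p+1}" for i
  proof (rule ccontr)
    assume "v i \<noteq> 0"
    define V where "V = ?dot v v"
    have "V \<noteq> 0"
      unfolding V_def using that \<open>v i \<noteq> 0\<close> by (subst sum_nonneg_eq_0_iff) auto
    moreover have "V \<ge> 0" unfolding V_def by (rule sum_nonneg) simp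
    ultimately have V: "V > 0" by simp
    define t where "t = a / sqrt V"
    have t: "t \<noteq> 0" "t\<^sup>2 * V = a\<^sup>2" using V a by (auto simp: t_def power_divide)
    define x where "x = restrict (\<lambda>i. if i \<le> p + 1 then t * v i else if i = p + 2 then 1 else 0)
      {1..p+q+1}"
    have x: "\<And>i. i \<in> {1..p+1} \<Longrightarrow> x i = t * v i" by (simp add: x_def)
    have xl: "peval x (linform (p + 1) u) = t * ?dot u v" for u
      unfolding peval_linform sum_distrib_left by (rule sum.cong) (auto simp: x)
    have "(\<Sum>i=1..p+1. x i ^ 2) = t\<^sup>2 * V"
      unfolding V_def sum_distrib_left
      by (rule sum.cong) (auto simp: x power2_eq_square)
    moreover have "(\<Sum>j=p+2..p+q+1. x j ^ 2) = (\<Sum>j=p+2..p+q+1. if j = p + 2 then 1 else 0)"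
      by (rule sum.cong) (auto simp: x_def)
    moreover have "\<dots> = 1" using q by simp
    ultimately have "peval x (S_poly p q a) = 0" unfolding peval_S_poly using t by simp
    moreover have "x \<in> {1..p+q+1} \<rightarrow>\<^sub>E UNIV" by (simp add: x_def)
    ultimately have "x \<in> meridian p q a (linform (p + 1) b)"
      using bv xl[of b] by (simp add: meridian_def S_surface_def zero_set_def del: peval_linform)
    with sub have "peval x (linform (p + 1) b') = 0"
      by (auto simp: meridian_def zero_set_def)
    with xl[of b'] t have b'v: "?dot b' v = 0" by simp
    have "V = ?dot b' v - D * ?dot b v"
      unfolding V_def sum_distrib_left sum_subtractf[symmetric]
      by (rule sum.cong) (simp_all add: v_def algebra_simps)
    with b'v bv V show False by simp
  qed
  then have "linform (p + 1) b' = Cst D * linform (p + 1) b"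
    unfolding Cst_mult_linform by (intro linform_cong) (simp add: v_def)
  then show ?thesis by (rule that)
qed

lemma meridian_Cst_mult: "k \<noteq> 0 \<Longrightarrow> meridian p q a (Cst k * g) = meridian p q a g"
  by (auto simp: meridian_def zero_set_def peval_mult)

lemma form_multiplicity_Cst_mult:
  assumes "k \<noteq> 0"
  shows "form_multiplicity p q R (Cst k * g) = form_multiplicity p q R g"
proof -
  have inv: "Cst k * Cst (1 / k) = 1"
    using assms by (simp flip: Cst_mult)
  have "(Cst k * g) * Cst (1 / k) = (Cst k * Cst (1 / k)) * g" by (simp only: mult_ac)
  then have g: "(Cst k * g) * Cst (1 / k) = g" by (simp add: inv)
  have "(Cst k * g) ^ \<mu> dvd g ^ \<mu>" for \<mu>
    by (subst (2) g[symmetric]) (simp only: power_mult_distrib[of "Cst k * g"] dvd_triv_left)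
  moreover have "g ^ \<mu> dvd (Cst k * g) ^ \<mu>" for \<mu>
    by (simp add: power_mult_distrib)
  ultimately have "(Cst k * g) ^ \<mu> dvd E \<longleftrightarrow> g ^ \<mu> dvd E" for \<mu> E
    using dvd_trans by blast
  then show ?thesis by (simp add: form_multiplicity_def)
qed

text \<open>The multiplicity of a meridian can be computed from any linear form defining it, since all
  these forms are proportional.\<close>

lemma meridian_multiplicity_eq:
  assumes "q > 0" "a > 0" and g: "g \<in> W_space p - {0}"
    and \<mu>: "form_multiplicity p q R g = Some \<mu>"
  shows "meridian_multiplicity p q a R (meridian p q a g) = \<mu>"
  unfolding meridian_multiplicity_def
proof (rule the_equality)
  fix \<nu>
  assume "\<exists>g'\<in>W_space p - {0}. meridian p q a g = meridian p q a g' \<and>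
    form_multiplicity p q R g' = Some \<nu>"
  then obtain g' where g': "g' \<in> W_space p - {0}" "meridian p q a g = meridian p q a g'"
    "form_multiplicity p q R g' = Some \<nu>" by blast
  from g g'(1) obtain b b' where b: "g = linform (p + 1) b" "g' = linform (p + 1) b'"
    by (auto simp: W_space_eq)
  obtain k where k: "g' = Cst k * g"
    using meridian_subset_imp_proportional[of q a p b b'] assms g' g b by auto
  then have "k \<noteq> 0" using g' by auto
  with k \<mu> g'(3) show "\<nu> = \<mu>" by (simp add: form_multiplicity_Cst_mult)
qed (use g \<mu> in blast)

lemma form_multiplicity_le_1:
  assumes "form_multiplicity p q R g = Some \<mu>" and "\<not> g ^ 2 dvd extactic p q R"
  shows "\<mu> \<le> 1"
proof -
  let ?P = "\<lambda>\<mu>. g ^ \<mu> dvd extactic p q R"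
  have bound: "\<nu> \<le> 1" if "?P \<nu>" for \<nu>
  proof (rule ccontr)
    assume "\<not> \<nu> \<le> 1"
    then have "g ^ 2 dvd g ^ \<nu>" by (intro le_imp_power_dvd) simp
    with that assms(2) show False using dvd_trans by blast
  qed
  have "?P (GREATEST \<mu>. ?P \<mu>)"
    by (rule GreatestI_nat[of ?P 0 1]) (use bound in auto)
  then show ?thesis
    using assms(1) bound by (auto simp: form_multiplicity_def split: if_splits)
qed

text \<open>The maximum over independent sets is taken over a bounded set of cardinalities, so a single
  eigenvector is a witness for it.\<close>

lemma num_indep_eigenvectors_pos:
  assumes A: "A \<in> carrier_mat m m" and v: "eigenvector A v k"
  shows "num_indep_eigenvectors A \<ge> 1"
proof -
  interpret vec_space "TYPE(real)" m .
  have dim: "dim_row A = m" using A by simp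
  have v': "v \<in> carrier_vec m" "v \<noteq> 0\<^sub>v m" using v A by (auto simp: eigenvector_def)
  let ?E = "{v. \<exists>k. eigenvector A v k}"
  let ?S = "{card B | B. finite B \<and> B \<subseteq> ?E \<and> lin_indpt B}"
  have "?S \<subseteq> {..m}"
  proof clarify
    fix B assume "B \<subseteq> ?E" "lin_indpt B"
    moreover from this have "B \<subseteq> carrier_vec m" using A by (auto simp: eigenvector_def)
    ultimately show "card B \<le> m" using li_le_dim(2)[OF fin_dim] dim_is_n by simp
  qed
  then have fin: "finite ?S" by (rule finite_subset) simp
  have "lin_indpt {v}"
    using v' by (subst lindep_span) (auto simp: span_empty)
  then have "1 \<in> ?S" using v by (intro CollectI exI[of _ "{v}"]) auto
  then have "1 \<le> Max ?S" using fin by (rule Max_ge[rotated])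
  then show ?thesis by (simp add: num_indep_eigenvectors_def dim)
qed

theorem theorem4p4:
  fixes p q n :: nat and a :: real
    and R :: "nat \<Rightarrow> rpoly" and c :: "nat \<Rightarrow> nat \<Rightarrow> real"
  assumes "p > 0" and "q > 0" and "n = p + q + 1" and "a > 1"
    and "\<And>i. i \<in> {1..n} \<Longrightarrow> R i = (\<Sum>j=1..n. Cst (c i j) * X j) + Cst (c i 0)"
    and "vf_degree n R = 1"
    and "vf_defined_on_S p q a R"
  shows "finite (invariant_meridians p q a R) \<and>
    (\<Sum>M\<in>invariant_meridians p q a R. meridian_multiplicity p q a R M)
      \<le> num_indep_eigenvectors (mat (p+1) (p+1) (\<lambda>(i, j). c (i+1) (j+1)))"
proof (cases "invariant_meridians p q a R = {}")
  case True
  then show ?thesis by simp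
next
  case False
  let ?m = "p + 1" and ?A = "mat (p+1) (p+1) (\<lambda>(i, j). c (i+1) (j+1))"
  interpret affine_field_tangent_to_S p q n a R c
    by unfold_locales (use assms in auto)
  from False obtain M where "M \<in> invariant_meridians p q a R" by blast
  then obtain b \<mu> where M: "M = meridian p q a (linform ?m b)"
    and nz: "linform ?m b \<noteq> 0" and inv: "vf_invariant n R (linform ?m b)"
    and \<mu>: "form_multiplicity p q R (linform ?m b) = Some \<mu>"
    by (auto simp: invariant_meridians_def W_space_eq assms(3))
  have det: "det (extactic_mat n ?m R) \<noteq> 0"
    using \<mu> by (auto simp: form_multiplicity_def extactic_eq_det assms(3) split: if_splits)
  obtain i where i: "i \<in> {1..?m}" "b i \<noteq> 0" using nz by (auto simp: linform_eq_0_iff)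
  have "M' = M" if M': "M' \<in> invariant_meridians p q a R" for M'
  proof -
    from M' obtain b' where b': "M' = meridian p q a (linform ?m b')"
      "linform ?m b' \<noteq> 0" "vf_invariant n R (linform ?m b')"
      by (auto simp: invariant_meridians_def W_space_eq assms(3))
    have proportional: "Cst (b i) * linform ?m b' = Cst (b' i) * linform ?m b"
      by (rule linear_first_integrals_proportional[OF det invariant_linform_in_kernel(2)[OF inv] invariant_linform_in_kernel(2)[OF b'(3)] i(1)])
    then have "b' i \<noteq> 0" using i(2) b'(2) by auto
    with proportional i(2) show ?thesis unfolding M b'(1) by (metis meridian_Cst_mult)
  qed
  then have single: "invariant_meridians p q a R = {M}"
    using \<open>M \<in> invariant_meridians p q a R\<close> by blast
  have "?m \<le> n" using assms(3) by simp
  then have "\<not> linform ?m b ^ 2 dvd extactic p q R"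
    unfolding extactic_eq_det assms(3)[symmetric]
    by (rule extactic_not_divisible_by_square[OF _ block_linear invariant_linform_in_kernel(1)[OF inv] invariant_linform_in_kernel(2)[OF inv] nz det])
  then have "\<mu> \<le> 1" by (rule form_multiplicity_le_1[OF \<mu>])
  moreover have "meridian_multiplicity p q a R M = \<mu>"
    unfolding M by (rule meridian_multiplicity_eq) (use assms nz \<mu> in \<open>auto simp: W_space_eq\<close>)
  moreover have "eigenvector ?A (vec ?m (\<lambda>s. b (s + 1))) 0"
  proof -
    have "?A *\<^sub>v vec ?m (\<lambda>s. b (s + 1)) = 0\<^sub>v ?m"
    proof (rule eq_vecI)
      fix r assume r: "r < dim_vec (0\<^sub>v ?m :: real vec)"
      then have "(?A *\<^sub>v vec ?m (\<lambda>s. b (s + 1))) $ r = (\<Sum>s<?m. c (r + 1) (s + 1) * b (s + 1))"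
        by (simp add: scalar_prod_def lessThan_atLeast0)
      also have "\<dots> = (\<Sum>j=1..?m. c (r + 1) j * b j)"
        by (simp add: sum.atLeast1_atMost_eq del: sum.cl_ivl_Suc)
      also have "\<dots> = 0" by (rule invariant_linform_in_kernel(1)[OF inv]) (use r in auto)
      finally show "(?A *\<^sub>v vec ?m (\<lambda>s. b (s + 1))) $ r = 0\<^sub>v ?m $ r" using r by simp
    qed simp
    moreover have "vec ?m (\<lambda>s. b (s + 1)) \<noteq> 0\<^sub>v ?m"
    proof -
      obtain s where s: "i = s + 1" "s < ?m" using i(1) by (cases i) auto
      then have "vec ?m (\<lambda>s. b (s + 1)) $ s \<noteq> 0" using i(2) by simp
      with s(2) show ?thesis by (metis index_zero_vec(1))
    qed
    moreover have "0 \<cdot>\<^sub>v vec ?m (\<lambda>s. b (s + 1)) = 0\<^sub>v ?m" by (rule eq_vecI) simp_all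
    ultimately show ?thesis by (simp add: eigenvector_def)
  qed
  then have "num_indep_eigenvectors ?A \<ge> 1"
    by (intro num_indep_eigenvectors_pos[of _ ?m]) auto
  ultimately show ?thesis using single by simp
qed

end
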